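(* Let $r\in(0,\infty)$, $p\in(1,\infty)$, and $w\in A_p^{\mathrm{loc}}(r)$, where the underlying space is $\mathbb{R}$. There exists a positive constant $C$, depending on $p$, such that, for any $f\in L^p(w)$, $$\left\|M_rf\right\|_{L^p(w)}\le C\,[w]_{A_p^{\mathrm{loc}}(r)}^{\frac1{p-1}}\|f\|_{L^p(w)}.$$
   Context: Here the dimension is $n=1$, so cubes are intervals $Q\subset\mathbb{R}$ with length $\ell(Q)=|Q|$; $\fint_Qf:=\frac1{|Q|}\int_Qf$; $p':=\frac p{p-1}$. A constant said to depend on $p$ depends only on $p$ (not on $w$, $r$, $f$). A scalar weight is a non-negative locally integrable function taking values in $(0,\infty)$ almost everywhere. $A_p^{\mathrm{loc}}(r)$ is the set of all scalar weights $w$ with $$[w]_{A_p^{\mathrm{loc}}(r)}:=\sup_{Q:\ \ell(Q)\le r}\fint_Qw(x)\,dx\left\{\fint_Q[w(x)]^{-\frac{p'}p}\,dx\right\}^{\frac p{p'}}<\infty.$$ $\|f\|_{L^p(w)}:=[\int_{\mathbb{R}}|f(x)|^pw(x)\,dx]^{1/p}$. The local maximal operator is $M_rf(x):=\sup_{Q\ni x,\ \ell(Q)\le r}\frac1{|Q|}\int_Q|f(y)|\,dy$, the supremum being over all intervals $Q$ containing $x$ with $\ell(Q)\le r$. *)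

theory Defs
  imports "HOL-Analysis.Analysis"
begin

(* Conjugate exponent p'. *)
definition conj_exp :: "real \<Rightarrow> real" where
  "conj_exp p = p / (p - 1)"

(* t^a for t in [0,\<infinity>]; it is only used with exponents a > 0, for which
   0^a = 0 and \<infinity>^a = \<infinity>. *)
definition epowr :: "ennreal \<Rightarrow> real \<Rightarrow> ennreal" where
  "epowr t a = (if t = \<infinity> then \<infinity> else ennreal (enn2real t powr a))"

(* Cubes of the line are nondegenerate bounded intervals, open, closed or half-open. *)
definition cubes :: "real set set" where
  "cubes = {Q. is_interval Q \<and> bounded Q \<and> 0 < emeasure lebesgue Q}"

definition eavg :: "real set \<Rightarrow> (real \<Rightarrow> ennreal) \<Rightarrow> ennreal" where
  "eavg Q g = (\<integral>\<^sup>+ x \<in> Q. g x \<partial>lebesgue) / emeasure lebesgue Q"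

definition scalar_weight :: "(real \<Rightarrow> real) \<Rightarrow> bool" where
  "scalar_weight w \<longleftrightarrow>
     w \<in> borel_measurable lebesgue \<and>
     (\<forall>x. 0 \<le> w x) \<and>
     (AE x in lebesgue. 0 < w x) \<and>
     (\<forall>K. compact K \<longrightarrow> set_integrable lebesgue K w)"

(* The values (w x) powr (- p'/p) at zeros of w are irrelevant: for a weight these zeros
   form a null set. The outer exponent p / p' is p - 1 > 0. *)
definition Ap_loc_const :: "real \<Rightarrow> real \<Rightarrow> (real \<Rightarrow> real) \<Rightarrow> ennreal" where
  "Ap_loc_const p r w =
     (SUP Q \<in> {Q \<in> cubes. emeasure lebesgue Q \<le> ennreal r}.
        eavg Q (\<lambda>x. ennreal (w x)) *
        epowr (eavg Q (\<lambda>x. ennreal (w x powr (- (conj_exp p / p))))) (p / conj_exp p))"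

definition Ap_loc :: "real \<Rightarrow> real \<Rightarrow> (real \<Rightarrow> real) set" where
  "Ap_loc p r = {w. scalar_weight w \<and> Ap_loc_const p r w < \<infinity>}"

(* The norm of L^p(w), taken of the modulus g of a function; g may attain the value \<infinity>,
   as a maximal function can. *)
definition Lp_weight_norm :: "real \<Rightarrow> (real \<Rightarrow> real) \<Rightarrow> (real \<Rightarrow> ennreal) \<Rightarrow> ennreal" where
  "Lp_weight_norm p w g =
     epowr (\<integral>\<^sup>+ x. epowr (g x) p * ennreal (w x) \<partial>lebesgue) (1 / p)"

definition Lp_weight :: "real \<Rightarrow> (real \<Rightarrow> real) \<Rightarrow> (real \<Rightarrow> complex) set" where
  "Lp_weight p w =
     {f \<in> borel_measurable lebesgue. Lp_weight_norm p w (\<lambda>x. ennreal (cmod (f x))) < \<infinity>}"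

definition local_maximal :: "real \<Rightarrow> (real \<Rightarrow> complex) \<Rightarrow> real \<Rightarrow> ennreal" where
  "local_maximal r f x =
     (SUP Q \<in> {Q \<in> cubes. x \<in> Q \<and> emeasure lebesgue Q \<le> ennreal r}.
        eavg Q (\<lambda>y. ennreal (cmod (f y))))"

end

theory Submission
  imports Defs
begin

text \<open>
  The bound is the local form of Buckley's weighted inequality, and the argument is Lerner's. Put
  \<open>\<sigma> = w powr (- 1 / (p - 1))\<close> and write \<open>w(Q)\<close>, \<open>\<sigma>(Q)\<close> for the integrals of \<open>w\<close>, \<open>\<sigma>\<close> over \<open>Q\<close>.
  For an interval \<open>Q\<close> of length at most \<open>r\<close>,
  the quantity \<open>(\<integral>\<^sub>Q |f| / |Q|) powr (p - 1)\<close> is the product of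
  \<open>(w(Q) / |Q|) \<cdot> (\<sigma>(Q) / |Q|) powr (p - 1)\<close> and \<open>(|Q| / w(Q)) \<cdot> (\<integral>\<^sub>Q |f| / \<sigma>(Q)) powr (p - 1)\<close>.
  The first factor is at most the \<open>A\<^sub>p\<close> constant. In the second, the average of \<open>|f| / \<sigma>\<close> over \<open>Q\<close> with
  respect to the measure \<open>\<sigma> dx\<close> is at most the maximal function \<open>M\<^sub>\<sigma> (|f| / \<sigma>)\<close> at every point of \<open>Q\<close>, so
  the second factor is at most the average over \<open>Q\<close> of \<open>(M\<^sub>\<sigma> (|f| / \<sigma>)) powr (p - 1) / w\<close> with respect to
  \<open>w dx\<close>. Hence \<open>(M\<^sub>r f) powr (p - 1)\<close> is bounded pointwise by the \<open>A\<^sub>p\<close> constant times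
  \<open>M\<^sub>w ((M\<^sub>\<sigma> (|f| / \<sigma>)) powr (p - 1) / w)\<close>, up to a factor depending on \<open>p\<close> (lemma \<open>eavg_pow_le\<close>).

  On the line the uncentred maximal operator of any \<open>\<sigma>\<close>-finite Borel measure is bounded on its \<open>L\<^sup>q\<close>,
  \<open>q > 1\<close>, with a constant depending only on \<open>q\<close> (lemma \<open>strong_type\<close>): a finite family of intervals
  has a subfamily with the same union and overlap at most 2, which gives weak type (1,1), and the
  strong bound follows by truncation and the layer cake formula. Applying this with exponent
  \<open>p / (p - 1)\<close> for \<open>w dx\<close> and exponent \<open>p\<close> for \<open>\<sigma> dx\<close> yields the theorem; the powers of the weights
  match because \<open>w \<cdot> w powr (- p / (p - 1)) = \<sigma>\<close> and \<open>\<sigma> \<cdot> \<sigma> powr (- p) = w\<close>.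

  Locality enters only through the \<open>A\<^sub>p\<close> constant; the operators \<open>M\<^sub>\<sigma>\<close> and \<open>M\<^sub>w\<close> use intervals of all lengths.
  They are taken over open intervals with rational endpoints, which makes them measurable; an
  interval of length at most \<open>r\<close> lies in such an interval of at most twice its measure, for \<open>w dx\<close> and
  for \<open>\<sigma> dx\<close> (lemma \<open>rat_interval_doubling_cube\<close>).
\<close>

section \<open>Powers of extended non-negative reals\<close>

lemma epowr_ennreal: "0 \<le> x \<Longrightarrow> epowr (ennreal x) a = ennreal (x powr a)"
  by (simp add: epowr_def)

lemma epowr_mono:
  assumes "0 \<le> a" "s \<le> t"
  shows "epowr s a \<le> epowr t a"
  using assms
  by (cases s; cases t) (auto simp: epowr_def powr_mono2 ennreal_top_neq_zero top_unique)

lemma epowr_epowr: "epowr (epowr t a) b = epowr t (a * b)"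
  by (cases t) (auto simp: epowr_def powr_powr)

lemma epowr_one: "epowr t 1 = t"
  by (cases t) (auto simp: epowr_def)

lemma epowr_mult:
  assumes "0 < a"
  shows "epowr (s * t) a = epowr s a * epowr t a"
proof (cases "s = \<infinity> \<or> t = \<infinity>")
  case True
  then show ?thesis using assms
    by (cases s; cases t) (auto simp: epowr_def ennreal_mult_top ennreal_top_mult)
next
  case False
  then show ?thesis
    by (cases s; cases t)
      (auto simp: epowr_def powr_mult ennreal_mult'[symmetric] ennreal_mult_eq_top_iff enn2real_mult)
qed

lemma epowr_add:
  assumes "0 < a" "0 < b"
  shows "epowr t (a + b) = epowr t a * epowr t b"
  by (cases t) (auto simp: epowr_def powr_add ennreal_mult)

lemma borel_measurable_epowr [measurable]: "(\<lambda>t. epowr t a) \<in> borel_measurable borel"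
  unfolding epowr_def by measurable

lemma nn_integral_powr_from_0:
  fixes a c :: real
  assumes "0 < a" "0 \<le> c"
  shows "(\<integral>\<^sup>+ t. (if 0 < t \<and> t < c then ennreal (a * t powr (a - 1)) else 0) \<partial>lborel)
     = ennreal (c powr a)"
proof -
  have "((\<lambda>t. a * t powr (a - 1)) has_integral a * (c powr a / a)) {0..c}"
    using has_integral_mult_right[OF has_integral_powr_from_0[of "a - 1" c], of a] assms by simp
  from nn_integral_has_integral_lebesgue[OF _ this]
  have "(\<integral>\<^sup>+ t. ennreal (indicator {0..c} t * (a * t powr (a - 1))) \<partial>lborel) = ennreal (c powr a)"
    using assms by simp
  also have "(\<integral>\<^sup>+ t. ennreal (indicator {0..c} t * (a * t powr (a - 1))) \<partial>lborel)
    = (\<integral>\<^sup>+ t. (if 0 < t \<and> t < c then ennreal (a * t powr (a - 1)) else 0) \<partial>lborel)"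
    using AE_lborel_singleton[of 0] AE_lborel_singleton[of c]
    by (intro nn_integral_cong_AE, eventually_elim) (auto simp: indicator_def)
  finally show ?thesis by simp
qed

lemma epowr_layer_cake:
  assumes "0 < a"
  shows "(\<integral>\<^sup>+ t. (if 0 < t \<and> ennreal t < m then ennreal (a * t powr (a - 1)) else 0) \<partial>lborel)
     = epowr m a"
proof (cases m)
  case (real c)
  have "(\<integral>\<^sup>+ t. (if 0 < t \<and> ennreal t < m then ennreal (a * t powr (a - 1)) else 0) \<partial>lborel)
    = (\<integral>\<^sup>+ t. (if 0 < t \<and> t < c then ennreal (a * t powr (a - 1)) else 0) \<partial>lborel)"
    by (intro nn_integral_cong) (auto simp: real ennreal_less_iff)
  then show ?thesis
    using nn_integral_powr_from_0[OF assms real(1)] real by (simp add: epowr_ennreal)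
next
  case top
  let ?I = "\<integral>\<^sup>+ t. (if 0 < t \<and> ennreal t < m then ennreal (a * t powr (a - 1)) else 0) \<partial>lborel"
  have *: "ennreal y \<le> ?I" if "0 \<le> y" for y
  proof -
    have "ennreal y = ennreal ((y powr (1 / a)) powr a)"
      using assms that by (simp add: powr_powr)
    also have "\<dots> = (\<integral>\<^sup>+ t. (if 0 < t \<and> t < y powr (1 / a)
        then ennreal (a * t powr (a - 1)) else 0) \<partial>lborel)"
      using nn_integral_powr_from_0[OF assms, of "y powr (1 / a)"] by simp
    also have "\<dots> \<le> ?I"
      by (intro nn_integral_mono) (auto simp: top)
    finally show ?thesis .
  qed
  have "?I = top"
  proof (cases ?I)
    case (real c)
    then show ?thesis using *[of "c + 1"] by (simp add: ennreal_le_iff)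
  qed
  then show ?thesis by (simp add: top epowr_def)
qed

section \<open>Maximal operators of measures on the line\<close>

text \<open>A subfamily of minimal cardinality with the same union has overlap at most 2: among three
  intervals through a common point, the ones reaching furthest to the left and to the right cover the third.\<close>

lemma finite_interval_cover_overlap_2:
  fixes F :: "(real \<times> real) set"
  assumes "finite F"
  obtains G where "G \<subseteq> F" "(\<Union>I\<in>G. {fst I<..<snd I}) = (\<Union>I\<in>F. {fst I<..<snd I})"
    "\<And>x. card {I \<in> G. x \<in> {fst I<..<snd I}} \<le> 2"
proof -
  let ?U = "\<lambda>G. \<Union>I\<in>G. {fst I<..<snd I::real}"
  let ?P = "\<lambda>G. G \<subseteq> F \<and> ?U G = ?U F"
  obtain G where G: "?P G" and min: "\<And>H. ?P H \<Longrightarrow> card G \<le> card H"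
    using ex_has_least_nat[of ?P F card] by blast
  have fin: "finite G" using G assms finite_subset by blast
  have "card {I \<in> G. x \<in> {fst I<..<snd I}} \<le> 2" for x
  proof (rule ccontr)
    let ?H = "{I \<in> G. x \<in> {fst I<..<snd I}}"
    assume "\<not> ?thesis"
    then have c: "2 < card ?H" by simp
    then have ne: "?H \<noteq> {}" by (metis card.empty not_less_zero)
    have fH: "finite ?H" using fin by auto
    obtain I1 where I1: "I1 \<in> ?H" "\<And>I. I \<in> ?H \<Longrightarrow> fst I1 \<le> fst I"
      using arg_min_if_finite[OF fH ne, of fst] by (meson not_less)
    obtain I2 where I2: "I2 \<in> ?H" "\<And>I. I \<in> ?H \<Longrightarrow> - snd I2 \<le> - snd I"
      using arg_min_if_finite[OF fH ne, of "\<lambda>I. - snd I"] by (meson not_less)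
    have "card {I1, I2} \<le> 2" by (simp add: card_insert_if)
    then have "\<not> ?H \<subseteq> {I1, I2}" using c card_mono[of "{I1,I2}" ?H] by force
    then obtain I3 where I3: "I3 \<in> ?H" "I3 \<noteq> I1" "I3 \<noteq> I2" by blast
    have sub: "{fst I3<..<snd I3} \<subseteq> {fst I1<..<snd I1} \<union> {fst I2<..<snd I2}"
    proof
      fix y assume y: "y \<in> {fst I3<..<snd I3}"
      show "y \<in> {fst I1<..<snd I1} \<union> {fst I2<..<snd I2}"
        using y I1(1) I2(1) I1(2)[OF I3(1)] I2(2)[OF I3(1)] by (cases "y \<le> x") auto
    qed
    have "?U (G - {I3}) = ?U G"
    proof
      show "?U G \<subseteq> ?U (G - {I3})"
      proof
        fix y assume "y \<in> ?U G"
        then obtain I where I: "I \<in> G" "y \<in> {fst I<..<snd I}" by blast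
        show "y \<in> ?U (G - {I3})"
        proof (cases "I = I3")
          case True
          then have "y \<in> {fst I1<..<snd I1} \<or> y \<in> {fst I2<..<snd I2}" using sub I by blast
          moreover have "I1 \<in> G - {I3}" "I2 \<in> G - {I3}" using I1 I2 I3 by auto
          ultimately show ?thesis by blast
        qed (use I in blast)
      qed
    qed blast
    then have "?P (G - {I3})" using G by blast
    then have "card G \<le> card (G - {I3})" by (rule min)
    moreover have "card (G - {I3}) < card G" using I3 fin by (intro card_Diff1_less) auto
    ultimately show False by simp
  qed
  with G that show ?thesis by blast
qed

text \<open>The uncentred maximal function of \<open>g\<close> with respect to \<open>M\<close>, over the open intervals with
  rational endpoints. Restricting to a countable family gives measurability. By \<open>0 / 0 = 0\<close>, null
  intervals contribute nothing, and by \<open>a / \<infinity> = 0\<close> neither do intervals of infinite measure.\<close>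

definition maxfun :: "real measure \<Rightarrow> (real \<Rightarrow> ennreal) \<Rightarrow> real \<Rightarrow> ennreal" where
  "maxfun M g x = (SUP I \<in> {I \<in> \<rat> \<times> \<rat>. x \<in> {fst I<..<snd I}}.
     (\<integral>\<^sup>+ y \<in> {fst I<..<snd I}. g y \<partial>M) / emeasure M {fst I<..<snd I})"

lemma countable_rat_pairs: "countable (\<rat> \<times> \<rat> :: (real \<times> real) set)"
  by (intro countable_SIGMA countable_rat)

lemma maxfun_superlevel:
  "{x. t < maxfun M g x} = (\<Union>I \<in> {I \<in> \<rat> \<times> \<rat>.
      t < (\<integral>\<^sup>+ y \<in> {fst I<..<snd I}. g y \<partial>M) / emeasure M {fst I<..<snd I}}. {fst I<..<snd I})"
  unfolding maxfun_def less_SUP_iff by blast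

lemma less_divide_imp_mult_le_ennreal:
  assumes "t < A / (m::ennreal)"
  shows "t * m \<le> A"
proof (cases "m = 0")
  case False
  then have "A \<le> m * t \<Longrightarrow> A / m \<le> t"
    by (intro divide_le_posI_ennreal) (auto simp: zero_less_iff_neq_zero)
  then show ?thesis using assms by (metis linorder_not_le mult.commute linorder_linear)
qed simp

text \<open>The constant in the strong type bound: \<open>4\<close> from the truncated weak type inequality, the rest from
  integrating it against \<open>p t powr (p - 1)\<close>.\<close>

definition maximal_const :: "real \<Rightarrow> real" where
  "maximal_const p = 4 * p / (p - 1) * 2 powr (p - 1)"

lemma maximal_const_pos: "1 < p \<Longrightarrow> 0 < maximal_const p"
  unfolding maximal_const_def by simp

text \<open>Measures on the line that measure Borel sets; their \<open>\<sigma>\<close>-algebra may be larger, such as that of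
  the Lebesgue measurable sets.\<close>

locale real_line_measure =
  fixes M :: "real measure"
  assumes space_UNIV: "space M = UNIV" and sets_borel: "sets borel \<subseteq> sets M"
begin

lemma ivl_sets [measurable, simp]: "{a<..<b::real} \<in> sets M"
  using sets_borel by auto

lemma borel_measurable_maxfun [measurable]: "maxfun M g \<in> borel_measurable M"
proof (rule borel_measurableI_greater)
  fix t
  have "(\<Union>I \<in> {I \<in> \<rat> \<times> \<rat>.
      t < (\<integral>\<^sup>+ y \<in> {fst I<..<snd I}. g y \<partial>M) / emeasure M {fst I<..<snd I}}. {fst I<..<snd I})
      \<in> sets M"
    by (intro sets.countable_UN' countable_subset[OF _ countable_rat_pairs]) auto
  then show "{x \<in> space M. t < maxfun M g x} \<in> sets M"
    by (simp add: space_UNIV maxfun_superlevel)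
qed

lemma weak_type_finite:
  assumes g [measurable]: "g \<in> borel_measurable M" and F: "finite F"
    and avg: "\<And>I. I \<in> F \<Longrightarrow> t * emeasure M {fst I<..<snd I} \<le> (\<integral>\<^sup>+ y \<in> {fst I<..<snd I}. g y \<partial>M)"
  shows "t * emeasure M (\<Union>I\<in>F. {fst I<..<snd I}) \<le> 2 * (\<integral>\<^sup>+ y. g y \<partial>M)"
proof -
  obtain G where G: "G \<subseteq> F" "(\<Union>I\<in>G. {fst I<..<snd I}) = (\<Union>I\<in>F. {fst I<..<snd I})"
    "\<And>x. card {I \<in> G. x \<in> {fst I<..<snd I}} \<le> 2"
    by (rule finite_interval_cover_overlap_2[OF F]) blast
  have fin: "finite G" using G F finite_subset by blast
  have "t * emeasure M (\<Union>I\<in>F. {fst I<..<snd I}) \<le> t * (\<Sum>I\<in>G. emeasure M {fst I<..<snd I})"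
    unfolding G(2)[symmetric]
    by (rule mult_left_mono[OF emeasure_subadditive_finite[OF fin]]) auto
  also have "\<dots> \<le> (\<Sum>I\<in>G. \<integral>\<^sup>+ y \<in> {fst I<..<snd I}. g y \<partial>M)"
    unfolding sum_distrib_left by (rule sum_mono) (use G(1) avg in blast)
  also have "\<dots> = (\<integral>\<^sup>+ y. (\<Sum>I\<in>G. g y * indicator {fst I<..<snd I} y) \<partial>M)"
    by (subst nn_integral_sum) auto
  also have "\<dots> \<le> (\<integral>\<^sup>+ y. 2 * g y \<partial>M)"
  proof (rule nn_integral_mono)
    fix y
    have "(\<Sum>I\<in>G. g y * indicator {fst I<..<snd I} y)
      = (\<Sum>I\<in>{I \<in> G. y \<in> {fst I<..<snd I}}. g y)"
      by (rule sum.mono_neutral_cong_right) (auto simp: indicator_def fin)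
    also have "\<dots> = of_nat (card {I \<in> G. y \<in> {fst I<..<snd I}}) * g y" by (rule sum_constant)
    also have "\<dots> \<le> of_nat 2 * g y"
      by (rule mult_right_mono[OF of_nat_mono[OF G(3)]]) simp
    finally show "(\<Sum>I\<in>G. g y * indicator {fst I<..<snd I} y) \<le> 2 * g y" by simp
  qed
  also have "\<dots> = 2 * (\<integral>\<^sup>+ y. g y \<partial>M)" by (rule nn_integral_cmult) auto
  finally show ?thesis .
qed

lemma weak_type:
  assumes g [measurable]: "g \<in> borel_measurable M"
  shows "t * emeasure M {x. t < maxfun M g x} \<le> 2 * (\<integral>\<^sup>+ y. g y \<partial>M)"
proof -
  define J where "J = {I \<in> \<rat> \<times> \<rat>.
      t < (\<integral>\<^sup>+ y \<in> {fst I<..<snd I}. g y \<partial>M) / emeasure M {fst I<..<snd I}}"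
  have cJ: "countable J" unfolding J_def
    by (rule countable_subset[OF _ countable_rat_pairs]) auto
  have eq: "{x. t < maxfun M g x} = (\<Union>I\<in>J. {fst I<..<snd I})"
    unfolding J_def by (rule maxfun_superlevel)
  show ?thesis
  proof (cases "J = {}")
    case False
    define U where "U n = (\<Union>I\<in>from_nat_into J ` {..n}. {fst I<..<snd I})" for n
    have Un: "(\<Union>n. U n) = (\<Union>I\<in>J. {fst I<..<snd I})"
    proof -
      have "(\<Union>n. U n) = (\<Union>I\<in>range (from_nat_into J). {fst I<..<snd I})"
        unfolding U_def by auto
      then show ?thesis unfolding range_from_nat_into[OF False cJ] .
    qed
    have inc: "incseq U" unfolding U_def incseq_def by fastforce
    have "emeasure M (\<Union>n. U n) = (SUP n. emeasure M (U n))"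
      by (rule SUP_emeasure_incseq[symmetric, OF _ inc]) (auto simp: U_def)
    moreover have "t * emeasure M (U n) \<le> 2 * (\<integral>\<^sup>+ y. g y \<partial>M)" for n
      unfolding U_def
    proof (rule weak_type_finite)
      fix I assume "I \<in> from_nat_into J ` {..n}"
      then have "I \<in> J" using from_nat_into[OF False] by auto
      then have "t < (\<integral>\<^sup>+ y \<in> {fst I<..<snd I}. g y \<partial>M) / emeasure M {fst I<..<snd I}"
        unfolding J_def by simp
      then show "t * emeasure M {fst I<..<snd I} \<le> (\<integral>\<^sup>+ y \<in> {fst I<..<snd I}. g y \<partial>M)"
        by (rule less_divide_imp_mult_le_ennreal)
    qed auto
    ultimately show ?thesis
      unfolding eq Un by (simp add: SUP_mult_left_ennreal SUP_le_iff)
  qed (simp add: eq)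
qed

lemma maxfun_le_add:
  assumes [measurable]: "h \<in> borel_measurable M" and le: "\<And>y. g y \<le> c + h y"
  shows "maxfun M g x \<le> c + maxfun M h x"
  unfolding maxfun_def
proof (rule SUP_least)
  fix I assume I: "I \<in> {I \<in> \<rat> \<times> \<rat>. x \<in> {fst I<..<snd I}}"
  let ?I = "{fst I<..<snd I}"
  have "(\<integral>\<^sup>+ y \<in> ?I. g y \<partial>M) \<le> (\<integral>\<^sup>+ y. c * indicator ?I y + h y * indicator ?I y \<partial>M)"
    using le by (intro nn_integral_mono) (auto simp: indicator_def)
  also have "\<dots> = c * emeasure M ?I + (\<integral>\<^sup>+ y \<in> ?I. h y \<partial>M)"
    by (subst nn_integral_add) (auto simp: nn_integral_cmult_indicator)
  finally have "(\<integral>\<^sup>+ y \<in> ?I. g y \<partial>M) / emeasure M ?I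
      \<le> (c * emeasure M ?I + (\<integral>\<^sup>+ y \<in> ?I. h y \<partial>M)) / emeasure M ?I"
    by (rule divide_right_mono_ennreal)
  also have "\<dots> = c * (emeasure M ?I / emeasure M ?I) + (\<integral>\<^sup>+ y \<in> ?I. h y \<partial>M) / emeasure M ?I"
    by (simp add: add_divide_distrib_ennreal ennreal_times_divide)
  also have "\<dots> \<le> c + (\<integral>\<^sup>+ y \<in> ?I. h y \<partial>M) / emeasure M ?I"
  proof -
    have "emeasure M ?I / emeasure M ?I \<le> 1"
      by (cases "emeasure M ?I = 0"; cases "emeasure M ?I = top") (auto simp: less_top)
    from mult_left_mono[OF this, of c] show ?thesis by (auto intro: add_right_mono)
  qed
  also have "\<dots> \<le> c + (SUP I \<in> {I \<in> \<rat> \<times> \<rat>. x \<in> {fst I<..<snd I}}.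
     (\<integral>\<^sup>+ y \<in> {fst I<..<snd I}. h y \<partial>M) / emeasure M {fst I<..<snd I})"
    using I by (intro add_left_mono SUP_upper)
  finally show "(\<integral>\<^sup>+ y \<in> ?I. g y \<partial>M) / emeasure M ?I \<le> c + (SUP I \<in> {I \<in> \<rat> \<times> \<rat>. x \<in> {fst I<..<snd I}}.
     (\<integral>\<^sup>+ y \<in> {fst I<..<snd I}. h y \<partial>M) / emeasure M {fst I<..<snd I})" .
qed

text \<open>Replacing \<open>g\<close> by its part above \<open>t / 2\<close>: the rest of \<open>g\<close> has averages at most \<open>t / 2\<close>.\<close>

lemma weak_type_truncated:
  assumes g [measurable]: "g \<in> borel_measurable M" and t: "0 < t"
  shows "emeasure M {x. ennreal t < maxfun M g x}
     \<le> ennreal (4 / t) * (\<integral>\<^sup>+ y. (if ennreal t < 2 * g y then g y else 0) \<partial>M)"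
proof -
  define h where "h y = (if ennreal t < 2 * g y then g y else 0)" for y
  have h [measurable]: "h \<in> borel_measurable M" unfolding h_def by measurable
  have "g y \<le> ennreal (t / 2) + h y" for y
    unfolding h_def using t
    by (cases "g y") (auto simp: not_less ennreal_mult'[symmetric] ennreal_numeral[symmetric]
       ennreal_le_iff ennreal_less_iff simp del: ennreal_numeral)
  from maxfun_le_add[OF h this] have le: "maxfun M g x \<le> ennreal (t / 2) + maxfun M h x" for x .
  have "{x. ennreal t < maxfun M g x} \<subseteq> {x. ennreal (t / 2) < maxfun M h x}"
  proof safe
    fix x assume "ennreal t < maxfun M g x"
    then have "ennreal t < ennreal (t / 2) + maxfun M h x" using le less_le_trans by blast
    then show "ennreal (t / 2) < maxfun M h x"
      using t by (cases "maxfun M h x") (auto simp: ennreal_less_iff ennreal_plus[symmetric] simp del: ennreal_plus)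
  qed
  then have "emeasure M {x. ennreal t < maxfun M g x} \<le> emeasure M {x. ennreal (t / 2) < maxfun M h x}"
  proof (rule emeasure_mono)
    have "{x \<in> space M. ennreal (t / 2) < maxfun M h x} \<in> sets M" by measurable
    then show "{x. ennreal (t / 2) < maxfun M h x} \<in> sets M" by (simp add: space_UNIV)
  qed
  also have "\<dots> = ennreal (2 / t) * (ennreal (t / 2) * emeasure M {x. ennreal (t / 2) < maxfun M h x})"
    using t by (simp add: mult.assoc[symmetric] ennreal_mult'[symmetric])
  also have "\<dots> \<le> ennreal (2 / t) * (2 * (\<integral>\<^sup>+ y. h y \<partial>M))"
    by (intro mult_left_mono weak_type) auto
  also have "\<dots> = ennreal (4 / t) * (\<integral>\<^sup>+ y. h y \<partial>M)"
  proof -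
    have "ennreal (4 / t) = ennreal (2 / t) * 2"
      using t by (simp add: ennreal_mult'[symmetric] ennreal_numeral[symmetric] del: ennreal_numeral)
    then show ?thesis by (simp add: mult.assoc)
  qed
  finally show ?thesis unfolding h_def .
qed

lemma strong_type:
  assumes sf: "sigma_finite_measure M" and p: "1 < p" and g [measurable]: "g \<in> borel_measurable M"
  shows "(\<integral>\<^sup>+ x. epowr (maxfun M g x) p \<partial>M)
    \<le> ennreal (maximal_const p) * (\<integral>\<^sup>+ x. epowr (g x) p \<partial>M)"
proof -
  interpret sigma_finite_measure M by (rule sf)
  interpret P: pair_sigma_finite M lborel ..
  let ?m = "maxfun M g"
  have "(\<integral>\<^sup>+ x. epowr (?m x) p \<partial>M)
    = (\<integral>\<^sup>+ x. \<integral>\<^sup>+ t. (if 0 < t \<and> ennreal t < ?m x then ennreal (p * t powr (p - 1)) else 0) \<partial>lborel \<partial>M)"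
    using p by (subst epowr_layer_cake) auto
  also have "\<dots> = (\<integral>\<^sup>+ t. \<integral>\<^sup>+ x. (if 0 < t \<and> ennreal t < ?m x then ennreal (p * t powr (p - 1)) else 0) \<partial>M \<partial>lborel)"
    by (rule P.Fubini'[symmetric]) measurable
  also have "\<dots> \<le> (\<integral>\<^sup>+ t. \<integral>\<^sup>+ x. ennreal (4 * p / (p - 1)) * (g x *
      (if 0 < t \<and> ennreal t < 2 * g x then ennreal ((p - 1) * t powr (p - 1 - 1)) else 0)) \<partial>M \<partial>lborel)"
  proof (rule nn_integral_mono)
    fix t :: real
    show "(\<integral>\<^sup>+ x. (if 0 < t \<and> ennreal t < ?m x then ennreal (p * t powr (p - 1)) else 0) \<partial>M)
       \<le> (\<integral>\<^sup>+ x. ennreal (4 * p / (p - 1)) * (g x *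
      (if 0 < t \<and> ennreal t < 2 * g x then ennreal ((p - 1) * t powr (p - 1 - 1)) else 0)) \<partial>M)"
    proof (cases "0 < t")
      case True
      have meas: "{x. ennreal t < ?m x} \<in> sets M"
      proof -
        have "{x \<in> space M. ennreal t < ?m x} \<in> sets M" by measurable
        then show ?thesis by (simp add: space_UNIV)
      qed
      have "(\<integral>\<^sup>+ x. (if 0 < t \<and> ennreal t < ?m x then ennreal (p * t powr (p - 1)) else 0) \<partial>M)
        = (\<integral>\<^sup>+ x. ennreal (p * t powr (p - 1)) * indicator {x. ennreal t < ?m x} x \<partial>M)"
        using True by (intro nn_integral_cong) auto
      also have "\<dots> = ennreal (p * t powr (p - 1)) * emeasure M {x. ennreal t < ?m x}"
        by (rule nn_integral_cmult_indicator[OF meas])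
      also have "\<dots> \<le> ennreal (p * t powr (p - 1)) *
          (ennreal (4 / t) * (\<integral>\<^sup>+ y. (if ennreal t < 2 * g y then g y else 0) \<partial>M))"
        by (intro mult_left_mono weak_type_truncated g True) auto
      also have "\<dots> = ennreal (4 * p / (p - 1) * ((p - 1) * t powr (p - 1 - 1))) *
          (\<integral>\<^sup>+ y. (if ennreal t < 2 * g y then g y else 0) \<partial>M)"
      proof -
        have "p * t powr (p - 1) * (4 / t) = 4 * p / (p - 1) * ((p - 1) * t powr (p - 1 - 1))"
          using True p by (simp add: powr_diff power2_eq_square)
        then show ?thesis using p True
          by (simp add: mult.assoc[symmetric] ennreal_mult''[symmetric])
      qed
      also have "\<dots> = (\<integral>\<^sup>+ x. ennreal (4 * p / (p - 1) * ((p - 1) * t powr (p - 1 - 1))) *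
          (if ennreal t < 2 * g x then g x else 0) \<partial>M)"
        by (rule nn_integral_cmult[symmetric]) measurable
      also have "\<dots> = (\<integral>\<^sup>+ x. ennreal (4 * p / (p - 1)) * (g x *
      (if 0 < t \<and> ennreal t < 2 * g x then ennreal ((p - 1) * t powr (p - 1 - 1)) else 0)) \<partial>M)"
      proof (rule nn_integral_cong)
        fix x
        have "ennreal (4 * p / (p - 1) * ((p - 1) * t powr (p - 1 - 1)))
          = ennreal (4 * p / (p - 1)) * ennreal ((p - 1) * t powr (p - 1 - 1))"
          using p by (intro ennreal_mult') simp
        then show "ennreal (4 * p / (p - 1) * ((p - 1) * t powr (p - 1 - 1))) *
            (if ennreal t < 2 * g x then g x else 0) = ennreal (4 * p / (p - 1)) * (g x *
            (if 0 < t \<and> ennreal t < 2 * g x then ennreal ((p - 1) * t powr (p - 1 - 1)) else 0))"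
          using True by (simp add: mult.assoc mult.commute[of _ "g x"])
      qed
      finally show ?thesis .
    qed simp
  qed
  also have "\<dots> = (\<integral>\<^sup>+ x. \<integral>\<^sup>+ t. ennreal (4 * p / (p - 1)) * (g x *
      (if 0 < t \<and> ennreal t < 2 * g x then ennreal ((p - 1) * t powr (p - 1 - 1)) else 0)) \<partial>lborel \<partial>M)"
    by (rule P.Fubini') measurable
  also have "\<dots> = (\<integral>\<^sup>+ x. ennreal (4 * p / (p - 1)) * (g x * epowr (2 * g x) (p - 1)) \<partial>M)"
  proof (rule nn_integral_cong)
    fix x
    show "(\<integral>\<^sup>+ t. ennreal (4 * p / (p - 1)) * (g x *
      (if 0 < t \<and> ennreal t < 2 * g x then ennreal ((p - 1) * t powr (p - 1 - 1)) else 0)) \<partial>lborel)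
      = ennreal (4 * p / (p - 1)) * (g x * epowr (2 * g x) (p - 1))"
      using p by (subst epowr_layer_cake[symmetric]) (auto simp: nn_integral_cmult)
  qed
  also have "\<dots> = (\<integral>\<^sup>+ x. ennreal (4 * p / (p - 1) * 2 powr (p - 1)) * epowr (g x) p \<partial>M)"
  proof (rule nn_integral_cong)
    fix x
    have eq1: "epowr (g x) p = g x * epowr (g x) (p - 1)"
      using epowr_add[of 1 "p - 1" "g x"] p by (simp add: epowr_one)
    have eq2: "epowr (2 * g x) (p - 1) = ennreal (2 powr (p - 1)) * epowr (g x) (p - 1)"
      using p epowr_ennreal[of 2 "p - 1"] by (simp add: epowr_mult)
    show "ennreal (4 * p / (p - 1)) * (g x * epowr (2 * g x) (p - 1)) =
      ennreal (4 * p / (p - 1) * 2 powr (p - 1)) * epowr (g x) p"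
    proof -
      have "ennreal (4 * p / (p - 1) * 2 powr (p - 1)) = ennreal (4 * p / (p - 1)) * ennreal (2 powr (p - 1))"
        by (rule ennreal_mult'') simp
      with eq1 eq2 show ?thesis by (simp only: mult_ac)
    qed
  qed
  also have "\<dots> = ennreal (4 * p / (p - 1) * 2 powr (p - 1)) * (\<integral>\<^sup>+ x. epowr (g x) p \<partial>M)"
    by (rule nn_integral_cmult) measurable
  finally show ?thesis unfolding maximal_const_def .
qed

end

section \<open>Intervals and densities\<close>

lemma sigma_finite_lebesgue: "sigma_finite_measure (lebesgue :: real measure)"
proof
  let ?A = "range (\<lambda>n::nat. {- real n..real n})"
  have "\<exists>n::nat. - real n \<le> x \<and> x \<le> real n" for x
  proof -
    obtain n :: nat where "\<bar>x\<bar> \<le> real n" using real_arch_simple by blast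
    then show ?thesis by (intro exI[of _ n]) auto
  qed
  then have UN: "\<Union>?A = space lebesgue" by auto
  have A: "countable ?A" "?A \<subseteq> sets lebesgue" "\<forall>a\<in>?A. emeasure lebesgue a \<noteq> \<infinity>" by auto
  show "\<exists>A. countable A \<and> A \<subseteq> sets (lebesgue :: real measure) \<and> \<Union> A = space lebesgue \<and>
      (\<forall>a\<in>A. emeasure lebesgue a \<noteq> \<infinity>)" by (intro exI[of _ ?A] conjI UN A)
qed

lemma AE_lebesgue_singleton: "AE x in lebesgue. x \<noteq> (c::real)"
  using AE_completion[OF AE_lborel_singleton[of c]] by simp

lemma cubes_sets:
  assumes "Q \<in> cubes"
  shows "Q \<in> sets lebesgue"
proof -
  have "Q \<in> sets borel"
    using assms real_interval_borel_measurable unfolding cubes_def by blast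
  then show ?thesis by simp
qed

lemma cubes_bounds:
  assumes "Q \<in> cubes"
  obtains a b where "a < b" "{a<..<b} \<subseteq> Q" "Q \<subseteq> {a..b}" "emeasure lebesgue Q = ennreal (b - a)"
proof -
  have iv: "is_interval Q" and bd: "bounded Q" and pos: "0 < emeasure lebesgue Q"
    using assms unfolding cubes_def by auto
  have ne: "Q \<noteq> {}" using pos by auto
  have bdd: "bdd_below Q" "bdd_above Q"
    using bd by (auto intro: bounded_imp_bdd_below bounded_imp_bdd_above)
  define a b where "a = Inf Q" and "b = Sup Q"
  have sub: "Q \<subseteq> {a..b}" unfolding a_def b_def using bdd by (auto intro: cInf_lower cSup_upper)
  have sup: "{a<..<b} \<subseteq> Q"
  proof
    fix x assume "x \<in> {a<..<b}"
    then have "Inf Q < x" "x < Sup Q" by (auto simp: a_def b_def)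
    then obtain y z where "y \<in> Q" "y < x" "z \<in> Q" "x < z"
      using cInf_less_iff[OF ne bdd(1)] less_cSup_iff[OF ne bdd(2)] by blast
    then show "x \<in> Q" using mem_is_interval_1_I[OF iv] by (meson less_imp_le)
  qed
  have ab: "a \<le> b" using sub ne by force
  have "emeasure lebesgue {a<..<b} \<le> emeasure lebesgue Q"
    by (rule emeasure_mono[OF sup cubes_sets[OF assms]])
  moreover have "emeasure lebesgue Q \<le> emeasure lebesgue {a..b}"
    by (rule emeasure_mono[OF sub]) simp
  ultimately have eq: "emeasure lebesgue Q = ennreal (b - a)" using ab by auto
  with pos have "a < b" by auto
  with that sub sup eq show ?thesis by blast
qed

lemma Icc_cubes: "a < b \<Longrightarrow> {a..b::real} \<in> cubes"
  by (auto simp: cubes_def is_interval_cc)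

lemma real_line_measure_density: "real_line_measure (density lebesgue u)"
  by standard (auto simp: sets_completionI_sets)

lemma density_cube_pos:
  assumes u [measurable]: "u \<in> borel_measurable lebesgue" and pos: "AE x in lebesgue. 0 < u x"
    and Q: "Q \<in> cubes"
  shows "0 < emeasure (density lebesgue u) Q"
proof -
  note [measurable] = cubes_sets[OF Q]
  have "emeasure (density lebesgue u) Q \<noteq> 0"
  proof
    assume "emeasure (density lebesgue u) Q = 0"
    then have "AE x in lebesgue. u x * indicator Q x = 0"
      by (simp add: emeasure_density nn_integral_0_iff_AE)
    with pos have "AE x in lebesgue. x \<notin> Q"
      by eventually_elim (auto simp: indicator_def)
    then have "emeasure lebesgue Q = 0"
      by (subst (asm) AE_iff_measurable[of Q]) auto
    then show False using Q by (simp add: cubes_def)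
  qed
  then show ?thesis by (simp add: zero_less_iff_neq_zero)
qed

text \<open>Continuity of the measure from above: the enlargements of \<open>[a, b]\<close> by \<open>1 / n\<close>, cut off at \<open>[c, d]\<close>
  where the measure is finite, decrease to \<open>[a, b]\<close>, which differs from \<open>Q\<close> by a null set.\<close>

lemma rat_interval_doubling_cube:
  fixes u :: "real \<Rightarrow> ennreal"
  defines "N \<equiv> density lebesgue u"
  assumes u [measurable]: "u \<in> borel_measurable lebesgue"
    and Q: "Q \<in> cubes" and sub: "Q \<subseteq> {a..b}" and sup: "{a<..<b} \<subseteq> Q"
    and cd: "c < a" "b < d" and fin: "emeasure N {c..d} < \<infinity>" and pos: "0 < emeasure N Q"
  obtains I where "I \<in> \<rat> \<times> \<rat>" "Q \<subseteq> {fst I<..<snd I}" "emeasure N {fst I<..<snd I} \<le> 2 * emeasure N Q"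
proof -
  note [measurable] = cubes_sets[OF Q]
  have sets [simp]: "sets N = sets lebesgue" unfolding N_def by simp
  have eqN: "emeasure N {a..b} = emeasure N Q"
  proof (rule emeasure_eq_AE)
    have "AE x in lebesgue. x \<in> {a..b} \<longleftrightarrow> x \<in> Q"
      using AE_lebesgue_singleton[of a] AE_lebesgue_singleton[of b]
    proof eventually_elim
      case (elim x)
      then show ?case using sub sup by (cases "x \<in> {a<..<b}") auto
    qed
    then show "AE x in N. x \<in> {a..b} \<longleftrightarrow> x \<in> Q"
      unfolding N_def by (subst AE_density) auto
  qed auto
  define A where "A n = {max c (a - 1 / real (Suc n))..min d (b + 1 / real (Suc n))}" for n
  have A_sets: "range A \<subseteq> sets N" by (auto simp: A_def)
  have dec: "decseq A"
  proof (rule decseq_SucI)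
    fix n
    have "1 / real (Suc (Suc n)) \<le> 1 / real (Suc n)" by (simp add: frac_le)
    then show "A (Suc n) \<subseteq> A n" unfolding A_def by auto
  qed
  have lim0: "(\<lambda>n. 1 / real (Suc n)) \<longlonglongrightarrow> 0" using LIMSEQ_inverse_real_of_nat by (simp add: inverse_eq_divide)
  have Int: "(\<Inter>n. A n) = {a..b}"
  proof
    show "(\<Inter>n. A n) \<subseteq> {a..b}"
    proof
      fix x assume x: "x \<in> (\<Inter>n. A n)"
      have "a - 1 / real (Suc n) \<le> x" "x \<le> b + 1 / real (Suc n)" for n
        using x by (auto simp: A_def)
      moreover have "(\<lambda>n. a - 1 / real (Suc n)) \<longlonglongrightarrow> a - 0" "(\<lambda>n. b + 1 / real (Suc n)) \<longlonglongrightarrow> b + 0"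
        by (intro tendsto_intros lim0)+
      ultimately have "a - 0 \<le> x" "x \<le> b + 0"
        by (meson LIMSEQ_le_const LIMSEQ_le_const2)+
      then show "x \<in> {a..b}" by simp
    qed
    show "{a..b} \<subseteq> (\<Inter>n. A n)"
    proof (intro INT_greatest)
      fix n
      have "0 \<le> 1 / real (Suc n)" by simp
      then show "{a..b} \<subseteq> A n" using cd unfolding A_def by auto
    qed
  qed
  have A_le: "emeasure N (A n) \<le> emeasure N {c..d}" for n
    by (rule emeasure_mono) (auto simp: A_def)
  have lim: "(\<lambda>n. emeasure N (A n)) \<longlonglongrightarrow> emeasure N {a..b}"
    unfolding Int[symmetric]
    by (rule Lim_emeasure_decseq[OF A_sets dec]) (metis A_le fin infinity_ennreal_def leD)
  have "emeasure N {a..b} < 2 * emeasure N Q"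
  proof -
    have "emeasure N {a..b} \<le> emeasure N {c..d}" using cd by (intro emeasure_mono) auto
    then have "emeasure N Q < top" using fin eqN by auto
    then show ?thesis using pos unfolding eqN
      by (cases "emeasure N Q") (auto simp: ennreal_less_iff ennreal_mult'[symmetric] ennreal_numeral[symmetric] simp del: ennreal_numeral)
  qed
  from order_tendstoD(2)[OF lim this] obtain n where n: "emeasure N (A n) < 2 * emeasure N Q"
    by (auto simp: eventually_sequentially)
  have "max c (a - 1 / real (Suc n)) < a" "b < min d (b + 1 / real (Suc n))" using cd by auto
  then obtain s t where st: "s \<in> \<rat>" "max c (a - 1 / real (Suc n)) < s" "s < a"
     "t \<in> \<rat>" "b < t" "t < min d (b + 1 / real (Suc n))"
    using Rats_dense_in_real by meson
  show ?thesis
  proof (rule that[of "(s, t)"])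
    have "{s<..<t} \<subseteq> A n" using st unfolding A_def by auto
    then have "emeasure N {s<..<t} \<le> emeasure N (A n)" by (rule emeasure_mono) (auto simp: A_def)
    with n show "emeasure N {fst (s, t)<..<snd (s, t)} \<le> 2 * emeasure N Q" by simp
    show "Q \<subseteq> {fst (s, t)<..<snd (s, t)}" using sub st by force
  qed (use st in auto)
qed

lemma ennreal_inverse_antimono: "a \<le> b \<Longrightarrow> inverse b \<le> inverse (a :: ennreal)"
proof (cases "a = 0 \<or> b = top")
  case False
  moreover assume "a \<le> b"
  ultimately obtain c d where "a = ennreal c" "b = ennreal d" "0 < c" "c \<le> d"
    by (cases a; cases b) (auto simp: top_unique)
  then show ?thesis by (simp add: inverse_ennreal le_imp_inverse_le)
qed auto

lemma nn_integral_density_cancel: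
  assumes u [measurable]: "u \<in> borel_measurable lebesgue" and pos: "AE x in lebesgue. 0 < u x"
    and Q: "Q \<in> cubes" and h [measurable]: "h \<in> borel_measurable lebesgue"
  shows "(\<integral>\<^sup>+ y \<in> Q. (h y * ennreal (1 / u y)) \<partial>density lebesgue (\<lambda>x. ennreal (u x)))
    = (\<integral>\<^sup>+ y \<in> Q. h y \<partial>lebesgue)"
proof -
  note [measurable] = cubes_sets[OF Q]
  have "(\<integral>\<^sup>+ y \<in> Q. (h y * ennreal (1 / u y)) \<partial>density lebesgue (\<lambda>x. ennreal (u x)))
    = (\<integral>\<^sup>+ y. ennreal (u y) * (h y * ennreal (1 / u y) * indicator Q y) \<partial>lebesgue)"
    by (rule nn_integral_density) measurable
  also have "\<dots> = (\<integral>\<^sup>+ y \<in> Q. h y \<partial>lebesgue)"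
  proof (rule nn_integral_cong_AE, use pos in eventually_elim)
    fix y assume "0 < u y"
    then have "ennreal (u y) * ennreal (1 / u y) = 1"
      by (simp add: ennreal_mult'[symmetric])
    then have "h y * indicator Q y * (ennreal (u y) * ennreal (1 / u y)) = h y * indicator Q y"
      by simp
    then show "ennreal (u y) * (h y * ennreal (1 / u y) * indicator Q y) = h y * indicator Q y"
      by (simp only: mult_ac)
  qed
  finally show ?thesis .
qed

lemma le_maxfun_of_doubling:
  assumes N: "N = density lebesgue u" and Q: "Q \<in> cubes"
    and I: "I \<in> \<rat> \<times> \<rat>" "Q \<subseteq> {fst I<..<snd I}" "emeasure N {fst I<..<snd I} \<le> 2 * emeasure N Q"
    and x: "x \<in> Q"
  shows "(\<integral>\<^sup>+ y \<in> Q. g y \<partial>N) / (2 * emeasure N Q) \<le> maxfun N g x"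
proof -
  have "(\<integral>\<^sup>+ y \<in> Q. g y \<partial>N) / (2 * emeasure N Q) \<le> (\<integral>\<^sup>+ y \<in> {fst I<..<snd I}. g y \<partial>N) / emeasure N {fst I<..<snd I}"
    unfolding divide_ennreal_def
  proof (rule mult_mono)
    show "(\<integral>\<^sup>+ y \<in> Q. g y \<partial>N) \<le> (\<integral>\<^sup>+ y \<in> {fst I<..<snd I}. g y \<partial>N)"
      using I(2) by (intro nn_integral_mono mult_left_mono) (auto simp: indicator_def)
    show "inverse (2 * emeasure N Q) \<le> inverse (emeasure N {fst I<..<snd I})"
      by (rule ennreal_inverse_antimono[OF I(3)])
  qed auto
  also have "\<dots> \<le> maxfun N g x"
    unfolding maxfun_def using I x by (intro SUP_upper) auto
  finally show ?thesis .
qed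

section \<open>The pointwise bound by two weighted maximal operators\<close>

locale local_Ap_weight =
  fixes p r :: real and w :: "real \<Rightarrow> real"
  assumes p: "1 < p" and r: "0 < r" and w_Ap: "w \<in> Ap_loc p r"
begin

text \<open>The dual weight \<open>\<sigma> = w powr (- 1 / (p - 1))\<close>; its exponent is \<open>- p'/p\<close>. It is \<open>0\<close> where \<open>w\<close> is.\<close>

definition dual :: "real \<Rightarrow> real" where
  "dual x = w x powr (- (1 / (p - 1)))"

text \<open>The measures \<open>w dx\<close> and \<open>\<sigma> dx\<close>.\<close>

definition W :: "real measure" where "W = density lebesgue (\<lambda>x. ennreal (w x))"

definition S :: "real measure" where "S = density lebesgue (\<lambda>x. ennreal (dual x))"

abbreviation "K \<equiv> Ap_loc_const p r w"

lemma w_meas [measurable]: "w \<in> borel_measurable lebesgue"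
  and w_nonneg: "0 \<le> w x"
  and w_pos: "AE x in lebesgue. 0 < w x"
  and w_int: "compact C \<Longrightarrow> set_integrable lebesgue C w"
  and K_finite: "K < \<infinity>"
  using w_Ap unfolding Ap_loc_def scalar_weight_def by auto

lemma dual_meas [measurable]: "dual \<in> borel_measurable lebesgue"
  unfolding dual_def by measurable

lemma dual_pos: "AE x in lebesgue. 0 < dual x"
  using w_pos unfolding dual_def by eventually_elim auto

sublocale W: real_line_measure W unfolding W_def by (rule real_line_measure_density)
sublocale S: real_line_measure S unfolding S_def by (rule real_line_measure_density)

lemma measurable_W [simp]: "borel_measurable W = borel_measurable lebesgue"
  and measurable_S [simp]: "borel_measurable S = borel_measurable lebesgue"
  unfolding W_def S_def by (rule measurable_cong_sets; simp)+

lemma sigma_finite_W: "sigma_finite_measure W" and sigma_finite_S: "sigma_finite_measure S"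
  unfolding W_def S_def
  by (subst sigma_finite_measure.sigma_finite_iff_density_finite[OF sigma_finite_lebesgue]; simp)+

lemma Ap_bound:
  assumes Q: "Q \<in> cubes" "emeasure lebesgue Q \<le> ennreal r"
  shows "(emeasure W Q / emeasure lebesgue Q) * epowr (emeasure S Q / emeasure lebesgue Q) (p - 1) \<le> K"
proof -
  note [measurable] = cubes_sets[OF Q(1)]
  have e: "conj_exp p / p = 1 / (p - 1)" "p / conj_exp p = p - 1"
    using p by (auto simp: conj_exp_def)
  have "eavg Q (\<lambda>x. ennreal (w x)) *
        epowr (eavg Q (\<lambda>x. ennreal (w x powr (- (conj_exp p / p))))) (p / conj_exp p) \<le> K"
    unfolding Ap_loc_const_def by (rule SUP_upper) (use Q in simp)
  then show ?thesis
    unfolding e eavg_def W_def S_def dual_def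
    by (simp add: emeasure_density)
qed

lemma W_Icc_finite: "emeasure W {a..b} < \<infinity>"
proof -
  have "integrable lebesgue (\<lambda>x. indicator {a..b} x *\<^sub>R w x)"
    using w_int[of "{a..b}"] by (simp add: set_integrable_def)
  then have "(\<integral>\<^sup>+ x. ennreal (indicator {a..b} x *\<^sub>R w x) \<partial>lebesgue) < \<infinity>"
    by (subst nn_integral_eq_integral) (auto simp: w_nonneg)
  also have "(\<integral>\<^sup>+ x. ennreal (indicator {a..b} x *\<^sub>R w x) \<partial>lebesgue) = emeasure W {a..b}"
    unfolding W_def by (subst emeasure_density) (auto intro!: nn_integral_cong simp: indicator_def)
  finally show ?thesis .
qed

lemma W_cube_pos: "Q \<in> cubes \<Longrightarrow> 0 < emeasure W Q"
  and S_cube_pos: "Q \<in> cubes \<Longrightarrow> 0 < emeasure S Q"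
  unfolding W_def S_def
  by (rule density_cube_pos; use w_pos dual_pos in simp)+

text \<open>The dual weight is integrable on short intervals because the first factor in the \<open>A\<^sub>p\<close> expression is
  positive and the product is finite.\<close>

lemma S_short_finite:
  assumes "a < b" "b - a \<le> r"
  shows "emeasure S {a..b} < \<infinity>"
proof (rule ccontr)
  note Q = Icc_cubes[OF assms(1)]
  have L: "emeasure lebesgue {a..b} = ennreal (b - a)" using assms(1) by simp
  assume "\<not> emeasure S {a..b} < \<infinity>"
  then have S: "emeasure S {a..b} = top" by (simp add: not_less top_unique)
  have "emeasure W {a..b} / emeasure lebesgue {a..b} \<noteq> 0"
    using W_cube_pos[OF Q] unfolding L by simp
  moreover have "epowr (emeasure S {a..b} / emeasure lebesgue {a..b}) (p - 1) = top"
    unfolding S L by (simp add: ennreal_top_divide epowr_def)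
  ultimately have "emeasure W {a..b} / emeasure lebesgue {a..b}
      * epowr (emeasure S {a..b} / emeasure lebesgue {a..b}) (p - 1) = top"
    using ennreal_mult_top by metis
  then have "top \<le> K"
    using Ap_bound[OF Q] assms L by (metis ennreal_leI)
  then show False using K_finite by (simp add: top_unique)
qed

text \<open>Lerner's pointwise inequality. The factor \<open>2 powr p\<close> is the cost of rational intervals:
  \<open>2 powr (p - 1)\<close> from the inner maximal function and \<open>2\<close> from the outer one.\<close>

lemma eavg_pow_le:
  assumes F [measurable]: "F \<in> borel_measurable lebesgue"
    and Q: "Q \<in> cubes" "emeasure lebesgue Q \<le> ennreal r" and x: "x \<in> Q"
  defines "m1 \<equiv> maxfun S (\<lambda>y. F y * ennreal (1 / dual y))"
  shows "epowr (eavg Q F) (p - 1)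
    \<le> ennreal (2 powr p) * K * maxfun W (\<lambda>y. epowr (m1 y) (p - 1) * ennreal (1 / w y)) x"
proof -
  note [measurable] = cubes_sets[OF Q(1)]
  obtain a b where ab: "a < b" "{a<..<b} \<subseteq> Q" "Q \<subseteq> {a..b}" and L: "emeasure lebesgue Q = ennreal (b - a)"
    using cubes_bounds[OF Q(1)] .
  have m1_meas [measurable]: "m1 \<in> borel_measurable lebesgue"
    using S.borel_measurable_maxfun unfolding m1_def by simp
  have br: "b - a \<le> r" using Q(2) r by (simp add: L)
  \<comment> \<open>The \<open>A\<^sub>p\<close> condition only sees intervals of length at most \<open>r\<close>, so a neighbourhood of \<open>Q\<close> is
    covered by three of them.\<close>
  have S_fin: "emeasure S {a - r..b + r} < \<infinity>"
  proof -
    have "emeasure S {a - r..b + r} \<le> emeasure S ({a - r..a} \<union> {a..b} \<union> {b..b + r})"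
      by (rule emeasure_mono) (auto simp: S_def)
    also have "\<dots> \<le> emeasure S {a - r..a} + emeasure S {a..b} + emeasure S {b..b + r}"
      by (intro order.trans[OF emeasure_subadditive] add_mono) (auto simp: S_def)
    also have "\<dots> < \<infinity>"
      using S_short_finite[of "a - r" a] S_short_finite[of a b] S_short_finite[of b "b + r"] br r ab(1) by simp
    finally show ?thesis .
  qed
  obtain I where I: "I \<in> \<rat> \<times> \<rat>" "Q \<subseteq> {fst I<..<snd I}"
      "emeasure S {fst I<..<snd I} \<le> 2 * emeasure S Q"
    unfolding S_def
    by (rule rat_interval_doubling_cube[OF _ Q(1) ab(3,2), of "\<lambda>x. ennreal (dual x)" "a - r" "b + r"])
       (use r S_fin S_cube_pos[OF Q(1)] in \<open>auto simp: S_def\<close>)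
  obtain J where J: "J \<in> \<rat> \<times> \<rat>" "Q \<subseteq> {fst J<..<snd J}"
      "emeasure W {fst J<..<snd J} \<le> 2 * emeasure W Q"
    unfolding W_def
    by (rule rat_interval_doubling_cube[OF _ Q(1) ab(3,2), of "\<lambda>x. ennreal (w x)" "a - r" "b + r"])
       (use r W_Icc_finite W_cube_pos[OF Q(1)] in \<open>auto simp: W_def\<close>)
  define A where "A = (\<integral>\<^sup>+ y \<in> Q. F y \<partial>lebesgue)"
  define s where "s = emeasure S Q"
  have "s \<le> emeasure S {a - r..b + r}" unfolding s_def
    using ab r by (intro emeasure_mono) (auto simp: S_def)
  then have s_fin: "s < top" using S_fin by auto
  have s_pos: "0 < s" unfolding s_def by (rule S_cube_pos[OF Q(1)])
  \<comment> \<open>Up to the factor 2, \<open>t\<close> is the \<open>S\<close>-average of \<open>F / dual\<close> over \<open>Q\<close>.\<close>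
  define t where "t = A / (2 * s)"
  have "A = (\<integral>\<^sup>+ y \<in> Q. (F y * ennreal (1 / dual y)) \<partial>S)"
    unfolding A_def S_def
    by (rule nn_integral_density_cancel[symmetric, OF dual_meas dual_pos Q(1) F])
  then have t_le: "t \<le> m1 y" if "y \<in> Q" for y
    using le_maxfun_of_doubling[OF S_def Q(1) I that] unfolding m1_def t_def s_def by simp
  have At: "A = t * (2 * s)"
    unfolding t_def using s_pos s_fin
    by (simp add: ennreal_divide_times ennreal_mult_less_top ennreal_divide_self[of "2 * s"])
  define T where "T = epowr t (p - 1)"
  have "T * ennreal (b - a) = (\<integral>\<^sup>+ y \<in> Q. T \<partial>lebesgue)"
    by (simp add: nn_integral_cmult_indicator L)
  also have "\<dots> \<le> (\<integral>\<^sup>+ y \<in> Q. epowr (m1 y) (p - 1) \<partial>lebesgue)"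
    using t_le p unfolding T_def
    by (intro nn_integral_mono) (auto simp: indicator_def intro: epowr_mono)
  also have "\<dots> = (\<integral>\<^sup>+ y \<in> Q. (epowr (m1 y) (p - 1) * ennreal (1 / w y)) \<partial>W)"
    unfolding W_def
    by (rule nn_integral_density_cancel[symmetric, OF w_meas w_pos Q(1)]) measurable
  finally have "T * ennreal (b - a) / (2 * emeasure W Q) \<le>
      (\<integral>\<^sup>+ y \<in> Q. (epowr (m1 y) (p - 1) * ennreal (1 / w y)) \<partial>W) / (2 * emeasure W Q)"
    by (rule divide_right_mono_ennreal)
  also have "\<dots> \<le> maxfun W (\<lambda>y. epowr (m1 y) (p - 1) * ennreal (1 / w y)) x"
    by (rule le_maxfun_of_doubling[OF W_def Q(1) J x])
  finally have m2: "T * ennreal (b - a) / (2 * emeasure W Q)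
    \<le> maxfun W (\<lambda>y. epowr (m1 y) (p - 1) * ennreal (1 / w y)) x" .
  have "emeasure W Q \<le> emeasure W {a..b}" using ab by (intro emeasure_mono) (auto simp: W_def)
  then have "emeasure W Q < top" using W_Icc_finite[of a b] by auto
  then obtain v where v: "emeasure W Q = ennreal v" "0 < v"
    using W_cube_pos[OF Q(1)] by (cases "emeasure W Q") auto
  define c where "c = epowr (s / ennreal (b - a)) (p - 1)"
  have c_le: "ennreal (v / (b - a)) * c \<le> K"
    using Ap_bound[OF Q] v ab(1) by (simp add: c_def s_def L divide_ennreal)
  have "T * ennreal ((b - a) / (2 * v)) = T * ennreal (b - a) / (2 * emeasure W Q)"
    using v ab(1)
    by (simp add: divide_ennreal ennreal_mult'[symmetric] ennreal_numeral[symmetric]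
       ennreal_times_divide[symmetric] del: ennreal_numeral)
  note m2' = m2[folded this]
  have "epowr (eavg Q F) (p - 1) = epowr (2 * (t * (s / ennreal (b - a)))) (p - 1)"
    unfolding eavg_def A_def[symmetric] L At by (simp add: ennreal_times_divide mult_ac)
  also have "\<dots> = ennreal (2 powr (p - 1)) * (T * c)"
    unfolding T_def c_def using p epowr_ennreal[of 2 "p - 1"] by (simp add: epowr_mult)
  also have "\<dots> = ennreal (2 powr p * ((v / (b - a)) * ((b - a) / (2 * v)))) * (T * c)"
    using v ab(1) by (simp add: powr_diff)
  also have "\<dots> = ennreal (2 powr p) * ((ennreal (v / (b - a)) * c) * (T * ennreal ((b - a) / (2 * v))))"
  proof -
    have "ennreal (2 powr p * ((v / (b - a)) * ((b - a) / (2 * v))))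
      = ennreal (2 powr p) * (ennreal (v / (b - a)) * ennreal ((b - a) / (2 * v)))"
      using v ab(1) by (subst ennreal_mult', simp, subst ennreal_mult') auto
    then show ?thesis by (simp only: mult_ac)
  qed
  also have "\<dots> \<le> ennreal (2 powr p) * (K * maxfun W (\<lambda>y. epowr (m1 y) (p - 1) * ennreal (1 / w y)) x)"
    by (intro mult_left_mono mult_mono c_le m2') auto
  finally show ?thesis by (simp only: mult.assoc)
qed

section \<open>The weighted norm inequality\<close>

lemma local_maximal_pow_le:
  assumes f [measurable]: "f \<in> borel_measurable lebesgue"
  defines "m1 \<equiv> maxfun S (\<lambda>y. ennreal (cmod (f y)) * ennreal (1 / dual y))"
  shows "epowr (local_maximal r f x) p
    \<le> epowr (ennreal (2 powr p) * K * maxfun W (\<lambda>y. epowr (m1 y) (p - 1) * ennreal (1 / w y)) x) (p / (p - 1))"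
proof -
  define B where "B = ennreal (2 powr p) * K * maxfun W (\<lambda>y. epowr (m1 y) (p - 1) * ennreal (1 / w y)) x"
  have "local_maximal r f x \<le> epowr B (1 / (p - 1))"
    unfolding local_maximal_def
  proof (rule SUP_least)
    fix Q assume "Q \<in> {Q \<in> cubes. x \<in> Q \<and> emeasure lebesgue Q \<le> ennreal r}"
    then have "epowr (eavg Q (\<lambda>y. ennreal (cmod (f y)))) (p - 1) \<le> B"
      unfolding B_def m1_def by (intro eavg_pow_le) auto
    then have "epowr (epowr (eavg Q (\<lambda>y. ennreal (cmod (f y)))) (p - 1)) (1 / (p - 1)) \<le> epowr B (1 / (p - 1))"
      using p by (intro epowr_mono) auto
    then show "eavg Q (\<lambda>y. ennreal (cmod (f y))) \<le> epowr B (1 / (p - 1))"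
      using p by (simp add: epowr_epowr epowr_one)
  qed
  then have "epowr (local_maximal r f x) p \<le> epowr (epowr B (1 / (p - 1))) p"
    using p by (intro epowr_mono) auto
  then show ?thesis unfolding B_def[symmetric] by (simp add: epowr_epowr)
qed

text \<open>The pointwise forms of \<open>w \<cdot> w powr (- p / (p - 1)) = \<sigma>\<close> and \<open>\<sigma> \<cdot> \<sigma> powr (- p) = w\<close>, with a
  factor \<open>m\<close> carried along.\<close>

lemma weight_identities:
  assumes "0 < w x"
  shows "ennreal (w x) * epowr (m * ennreal (1 / w x)) (p / (p - 1)) = ennreal (dual x) * epowr m (p / (p - 1))"
    and "ennreal (dual x) * epowr (m * ennreal (1 / dual x)) p = ennreal (w x) * epowr m p"
proof -
  have "w x * (1 / w x) powr (p / (p - 1)) = w x powr (1 - p / (p - 1))"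
    using assms by (simp add: powr_diff powr_divide)
  also have "1 - p / (p - 1) = - (1 / (p - 1))" using p by (simp add: field_simps)
  finally have 1: "w x * (1 / w x) powr (p / (p - 1)) = dual x" unfolding dual_def .
  have d: "0 < dual x" using assms unfolding dual_def by simp
  have "dual x * (1 / dual x) powr p = dual x powr (1 - p)"
    using d by (simp add: powr_diff powr_divide)
  also have "\<dots> = w x powr (- (1 / (p - 1)) * (1 - p))"
    unfolding dual_def by (rule powr_powr)
  also have "- (1 / (p - 1)) * (1 - p) = 1" using p by (simp add: field_simps)
  finally have 2: "dual x * (1 / dual x) powr p = w x" using assms by simp
  have "ennreal (w x) * epowr (m * ennreal (1 / w x)) (p / (p - 1))
      = epowr m (p / (p - 1)) * ennreal (w x * (1 / w x) powr (p / (p - 1)))"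
    using p assms by (simp add: epowr_mult epowr_ennreal ennreal_mult mult_ac)
  then show "ennreal (w x) * epowr (m * ennreal (1 / w x)) (p / (p - 1)) = ennreal (dual x) * epowr m (p / (p - 1))"
    unfolding 1 by (simp only: mult.commute)
  have "ennreal (dual x) * epowr (m * ennreal (1 / dual x)) p
      = epowr m p * ennreal (dual x * (1 / dual x) powr p)"
    using p d by (simp add: epowr_mult epowr_ennreal ennreal_mult mult_ac)
  then show "ennreal (dual x) * epowr (m * ennreal (1 / dual x)) p = ennreal (w x) * epowr m p"
    unfolding 2 by (simp only: mult.commute)
qed

lemma nn_integral_local_maximal_le:
  assumes f [measurable]: "f \<in> borel_measurable lebesgue"
  shows "(\<integral>\<^sup>+ x. epowr (local_maximal r f x) p * ennreal (w x) \<partial>lebesgue)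
    \<le> epowr (ennreal (2 powr p) * K) (p / (p - 1)) *
      (ennreal (maximal_const (p / (p - 1))) * (ennreal (maximal_const p) *
        (\<integral>\<^sup>+ x. epowr (ennreal (cmod (f x))) p * ennreal (w x) \<partial>lebesgue)))"
proof -
  let ?q = "p / (p - 1)"
  define \<phi> where "\<phi> y = ennreal (cmod (f y)) * ennreal (1 / dual y)" for y
  define m1 where "m1 = maxfun S \<phi>"
  define g where "g y = epowr (m1 y) (p - 1) * ennreal (1 / w y)" for y
  define m2 where "m2 = maxfun W g"
  have q: "1 < ?q" using p by (simp add: field_simps)
  have \<phi>_meas [measurable]: "\<phi> \<in> borel_measurable lebesgue" unfolding \<phi>_def by measurable
  have m1_meas [measurable]: "m1 \<in> borel_measurable lebesgue"
    using S.borel_measurable_maxfun unfolding m1_def by simp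
  have g_meas [measurable]: "g \<in> borel_measurable lebesgue" unfolding g_def by measurable
  have m2_meas [measurable]: "m2 \<in> borel_measurable lebesgue"
    using W.borel_measurable_maxfun unfolding m2_def by simp
  let ?B = "epowr (ennreal (2 powr p) * K) ?q"
  have "(\<integral>\<^sup>+ x. epowr (local_maximal r f x) p * ennreal (w x) \<partial>lebesgue)
    \<le> (\<integral>\<^sup>+ x. ?B * (ennreal (w x) * epowr (m2 x) ?q) \<partial>lebesgue)"
  proof (rule nn_integral_mono)
    fix x
    have "epowr (local_maximal r f x) p \<le> epowr (ennreal (2 powr p) * K * m2 x) ?q"
      using local_maximal_pow_le[OF f, of x] unfolding m2_def g_def m1_def \<phi>_def .
    also have "\<dots> = ?B * epowr (m2 x) ?q" using q by (intro epowr_mult) simp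
    finally have "epowr (local_maximal r f x) p * ennreal (w x) \<le> ?B * epowr (m2 x) ?q * ennreal (w x)"
      by (rule mult_right_mono) simp
    then show "epowr (local_maximal r f x) p * ennreal (w x) \<le> ?B * (ennreal (w x) * epowr (m2 x) ?q)"
      by (simp only: mult_ac)
  qed
  also have "\<dots> = ?B * (\<integral>\<^sup>+ x. ennreal (w x) * epowr (m2 x) ?q \<partial>lebesgue)"
    by (rule nn_integral_cmult) measurable
  also have "(\<integral>\<^sup>+ x. ennreal (w x) * epowr (m2 x) ?q \<partial>lebesgue) = (\<integral>\<^sup>+ x. epowr (m2 x) ?q \<partial>W)"
    unfolding W_def by (rule nn_integral_density[symmetric]) measurable
  also have "?B * \<dots> \<le> ?B * (ennreal (maximal_const ?q) * (\<integral>\<^sup>+ x. epowr (g x) ?q \<partial>W))"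
    unfolding m2_def by (intro mult_left_mono W.strong_type sigma_finite_W q) auto
  also have "(\<integral>\<^sup>+ x. epowr (g x) ?q \<partial>W) = (\<integral>\<^sup>+ x. ennreal (w x) * epowr (g x) ?q \<partial>lebesgue)"
    unfolding W_def by (rule nn_integral_density) measurable
  also have "\<dots> = (\<integral>\<^sup>+ x. ennreal (dual x) * epowr (m1 x) p \<partial>lebesgue)"
  proof (rule nn_integral_cong_AE, use w_pos in eventually_elim)
    fix x assume "0 < w x"
    have "(p - 1) * ?q = p" using p by simp
    with weight_identities(1)[OF \<open>0 < w x\<close>, of "epowr (m1 x) (p - 1)"]
    show "ennreal (w x) * epowr (g x) ?q = ennreal (dual x) * epowr (m1 x) p"
      unfolding g_def by (simp only: epowr_epowr)
  qed
  also have "\<dots> = (\<integral>\<^sup>+ x. epowr (m1 x) p \<partial>S)"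
    unfolding S_def by (rule nn_integral_density[symmetric]) measurable
  also have "?B * (ennreal (maximal_const ?q) * \<dots>)
    \<le> ?B * (ennreal (maximal_const ?q) * (ennreal (maximal_const p) * (\<integral>\<^sup>+ x. epowr (\<phi> x) p \<partial>S)))"
    unfolding m1_def by (intro mult_left_mono S.strong_type sigma_finite_S p) auto
  also have "(\<integral>\<^sup>+ x. epowr (\<phi> x) p \<partial>S) = (\<integral>\<^sup>+ x. ennreal (dual x) * epowr (\<phi> x) p \<partial>lebesgue)"
    unfolding S_def by (rule nn_integral_density) measurable
  also have "\<dots> = (\<integral>\<^sup>+ x. epowr (ennreal (cmod (f x))) p * ennreal (w x) \<partial>lebesgue)"
  proof (rule nn_integral_cong_AE, use w_pos in eventually_elim)
    fix x assume "0 < w x"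
    from weight_identities(2)[OF this, of "ennreal (cmod (f x))"]
    show "ennreal (dual x) * epowr (\<phi> x) p = epowr (ennreal (cmod (f x))) p * ennreal (w x)"
      unfolding \<phi>_def by (simp only: mult.commute)
  qed
  finally show ?thesis .
qed

end

theorem theorem5p1:
  fixes p :: real
  assumes "1 < p"
  shows "\<exists>C::real. 0 < C \<and>
    (\<forall>r::real. 0 < r \<longrightarrow>
      (\<forall>w \<in> Ap_loc p r. \<forall>f \<in> Lp_weight p w.
        Lp_weight_norm p w (local_maximal r f)
          \<le> ennreal C * epowr (Ap_loc_const p r w) (1 / (p - 1))
             * Lp_weight_norm p w (\<lambda>x. ennreal (cmod (f x)))))"
proof -
  let ?q = "p / (p - 1)"
  have q: "1 < ?q" using assms by (simp add: field_simps)
  define D where "D = maximal_const ?q * maximal_const p"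
  define C where "C = (2 powr p) powr (1 / (p - 1)) * D powr (1 / p)"
  have mc: "0 < maximal_const p" "0 < maximal_const ?q"
    using maximal_const_pos[OF assms] maximal_const_pos[OF q] .
  then have D: "0 < D" unfolding D_def by simp
  have "0 < C" unfolding C_def using D by simp
  moreover have "Lp_weight_norm p w (local_maximal r f)
      \<le> ennreal C * epowr (Ap_loc_const p r w) (1 / (p - 1))
        * Lp_weight_norm p w (\<lambda>x. ennreal (cmod (f x)))"
    if r: "0 < r" and w: "w \<in> Ap_loc p r" and f: "f \<in> Lp_weight p w" for r w f
  proof -
    interpret local_Ap_weight p r w using assms r w by unfold_locales
    define N where "N = (\<integral>\<^sup>+ x. epowr (ennreal (cmod (f x))) p * ennreal (w x) \<partial>lebesgue)"
    have "f \<in> borel_measurable lebesgue" using f unfolding Lp_weight_def by simp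
    from nn_integral_local_maximal_le[OF this]
    have "(\<integral>\<^sup>+ x. epowr (local_maximal r f x) p * ennreal (w x) \<partial>lebesgue)
      \<le> epowr (ennreal (2 powr p) * K) ?q * (ennreal D * N)"
      unfolding N_def[symmetric] D_def using mc by (simp add: ennreal_mult mult.assoc)
    then have "Lp_weight_norm p w (local_maximal r f)
      \<le> epowr (epowr (ennreal (2 powr p) * K) ?q * (ennreal D * N)) (1 / p)"
      unfolding Lp_weight_norm_def using assms by (intro epowr_mono) auto
    also have "\<dots> = epowr (ennreal (2 powr p) * K) (1 / (p - 1)) * (epowr (ennreal D) (1 / p) * epowr N (1 / p))"
      using assms by (simp add: epowr_mult epowr_epowr)
    also have "\<dots> = (ennreal ((2 powr p) powr (1 / (p - 1))) * ennreal (D powr (1 / p)))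
        * epowr K (1 / (p - 1)) * epowr N (1 / p)"
      using assms D by (simp add: epowr_mult epowr_ennreal mult_ac del: powr_powr)
    also have "ennreal ((2 powr p) powr (1 / (p - 1))) * ennreal (D powr (1 / p)) = ennreal C"
      unfolding C_def by (simp add: ennreal_mult)
    finally show ?thesis unfolding N_def Lp_weight_norm_def .
  qed
  ultimately show ?thesis by blast
qed

end
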